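(* Let $\mathtt{C}$ be a category with objects $\mathtt{C}_0$. Let $\mathtt{I}:\mathtt{C}_0\to\Delta$ be a surjective isomorphism invariant from the objects of $\mathtt{C}$ onto a type $\Delta$. There is a partial order $\leq$ on $\Delta$ and a functor $\mathbf{J}:\mathtt{C}\to\mathtt{LT}_{\Delta}^{\leq}$ such that $\mathbf{J}(x)=\mathtt{I}(x)$ for each $x:\mathtt{C}_0$. Furthermore, $(\mathtt{LT}_{\Delta}^{\leq},\mathbf{J})$ is universal in the following sense: for every thin category $\mathtt{R}$ with objects $\Delta$, and every functor $\mathbf{K}:\mathtt{C}\to\mathtt{R}$, where $\mathbf{K}(x)=\mathtt{I}(x)$ for each $x:\mathtt{C}_0$, there is a unique functor $\mathbf{L}:\mathtt{LT}_{\Delta}^{\leq}\to\mathtt{R}$ and a natural transformation from $\mathbf{L}\mathbf{J}$ to $\mathbf{K}$.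
   Context: An isomorphism invariant on $\mathtt{C}$ is a function $\mathtt{I}:\mathtt{C}_0\to\Delta$ such that $x\cong y$ in $\mathtt{C}$ implies $\mathtt{I}(x)=\mathtt{I}(y)$. Types are a generalization of sets, and $x:\mathtt{C}_0$ (analogous to $x\in\mathtt{C}_0$) means that $x$ is an object of $\mathtt{C}$. A (pre-)category is thin if there is at most one morphism between each ordered pair of objects; thin pre-categories are the same thing as pre-orders (reflexive transitive relations), with $x\preccurlyeq y$ meaning that there is a morphism $x\to y$. For an order $\leq$ on $\Delta$, $\mathtt{LT}_{\Delta}^{\leq}$ denotes the thin category with objects $\Delta$ having a (unique) morphism $\delta\to\epsilon$ exactly when $\delta\leq\epsilon$. Convention on equality (univalence): a "category" means a univalent category, that is, a pre-category (objects, morphisms, identities and an associative unital composition) in which isomorphic objects are regarded as equal, so equality between objects of a category is determined by the isomorphisms of that category. In particular, equality between terms of $\Delta$, as objects of $\mathtt{LT}_{\Delta}^{\leq}$, is determined by isomorphism in $\mathtt{LT}_{\Delta}^{\leq}$: $\delta=\epsilon$ precisely when $\delta\leq\epsilon\leq\delta$. Thus a "partial order on $\Delta$" is a pre-order on $\Delta$ made antisymmetric by this notion of equality (this is akin to the partial order that a pre-order $\preccurlyeq$ on $\Delta$ induces on the quotient of $\Delta$ by the relation $a\sim b\Leftrightarrow a\preccurlyeq b\preccurlyeq a$). Likewise, equality of objects in a thin category $\mathtt{R}$ with objects $\Delta$ is determined by isomorphism in $\mathtt{R}$.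
   Formalization: The natural transformation from LJ to K is required to be invertible, and L is unique (up to natural isomorphism) only among functors with such an isomorphism; with arbitrary transformations uniqueness fails, e.g. C discrete on {0,1}, I=id, R={0<1}. *)

theory Defs
  imports Main
begin

(* Only values at objects of Ob and at arrows of Hom between them are meaningful.
   Hom is a family indexed by pairs of objects, so distinct hom-sets may overlap. *)
record ('o, 'm) precat =
  Ob :: "'o set"
  Hom :: "'o \<Rightarrow> 'o \<Rightarrow> 'm set"
  ident :: "'o \<Rightarrow> 'm"
  comp :: "'o \<Rightarrow> 'o \<Rightarrow> 'o \<Rightarrow> 'm \<Rightarrow> 'm \<Rightarrow> 'm"
    \<comment> \<open>\<open>comp C x y z g f\<close> is \<open>g\<close> after \<open>f\<close>, for \<open>f : x \<rightarrow> y\<close> and \<open>g : y \<rightarrow> z\<close>\<close>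

(* Univalence is not an axiom here: HOL equality of objects would make every univalent
   category skeletal.  Instead, equality of objects of a category is the relation
   obj_eq below (isomorphism), and equality of functors is functor_eq. *)
definition category :: "('o, 'm) precat \<Rightarrow> bool" where
  "category C \<longleftrightarrow>
     (\<forall>x\<in>Ob C. ident C x \<in> Hom C x x) \<and>
     (\<forall>x\<in>Ob C. \<forall>y\<in>Ob C. \<forall>z\<in>Ob C. \<forall>f\<in>Hom C x y. \<forall>g\<in>Hom C y z.
        comp C x y z g f \<in> Hom C x z) \<and>
     (\<forall>x\<in>Ob C. \<forall>y\<in>Ob C. \<forall>f\<in>Hom C x y.
        comp C x x y f (ident C x) = f \<and> comp C x y y (ident C y) f = f) \<and>
     (\<forall>w\<in>Ob C. \<forall>x\<in>Ob C. \<forall>y\<in>Ob C. \<forall>z\<in>Ob C.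
        \<forall>f\<in>Hom C w x. \<forall>g\<in>Hom C x y. \<forall>h\<in>Hom C y z.
          comp C w x z (comp C x y z h g) f = comp C w y z h (comp C w x y g f))"

definition is_iso :: "('o, 'm) precat \<Rightarrow> 'o \<Rightarrow> 'o \<Rightarrow> 'm \<Rightarrow> bool" where
  "is_iso C x y f \<longleftrightarrow>
     f \<in> Hom C x y \<and>
     (\<exists>g\<in>Hom C y x. comp C x y x g f = ident C x \<and> comp C y x y f g = ident C y)"

definition obj_eq :: "('o, 'm) precat \<Rightarrow> 'o \<Rightarrow> 'o \<Rightarrow> bool" where
  "obj_eq C x y \<longleftrightarrow> x \<in> Ob C \<and> y \<in> Ob C \<and> (\<exists>f. is_iso C x y f)"

definition thin :: "('o, 'm) precat \<Rightarrow> bool" where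
  "thin C \<longleftrightarrow> (\<forall>x\<in>Ob C. \<forall>y\<in>Ob C. \<forall>f\<in>Hom C x y. \<forall>g\<in>Hom C x y. f = g)"

definition isomorphism_invariant :: "('o, 'm) precat \<Rightarrow> 'd set \<Rightarrow> ('o \<Rightarrow> 'd) \<Rightarrow> bool" where
  "isomorphism_invariant C \<Delta> I \<longleftrightarrow>
     I ` Ob C \<subseteq> \<Delta> \<and>
     (\<forall>x\<in>Ob C. \<forall>y\<in>Ob C. (\<exists>f. is_iso C x y f) \<longrightarrow> I x = I y)"

record ('o, 'm, 'p, 'n) func =
  fobj :: "'o \<Rightarrow> 'p"
  farr :: "'o \<Rightarrow> 'o \<Rightarrow> 'm \<Rightarrow> 'n"

definition is_functor :: "('o, 'm) precat \<Rightarrow> ('p, 'n) precat \<Rightarrow> ('o, 'm, 'p, 'n) func \<Rightarrow> bool" where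
  "is_functor C D F \<longleftrightarrow>
     (\<forall>x\<in>Ob C. fobj F x \<in> Ob D) \<and>
     (\<forall>x\<in>Ob C. \<forall>y\<in>Ob C. \<forall>f\<in>Hom C x y. farr F x y f \<in> Hom D (fobj F x) (fobj F y)) \<and>
     (\<forall>x\<in>Ob C. farr F x x (ident C x) = ident D (fobj F x)) \<and>
     (\<forall>x\<in>Ob C. \<forall>y\<in>Ob C. \<forall>z\<in>Ob C. \<forall>f\<in>Hom C x y. \<forall>g\<in>Hom C y z.
        farr F x z (comp C x y z g f)
          = comp D (fobj F x) (fobj F y) (fobj F z) (farr F y z g) (farr F x y f))"

definition func_comp ::
  "('p, 'n, 'q, 'k) func \<Rightarrow> ('o, 'm, 'p, 'n) func \<Rightarrow> ('o, 'm, 'q, 'k) func" where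
  "func_comp G F =
     \<lparr> fobj = (\<lambda>x. fobj G (fobj F x)),
       farr = (\<lambda>x y f. farr G (fobj F x) (fobj F y) (farr F x y f)) \<rparr>"

definition natural_transformation ::
  "('o, 'm) precat \<Rightarrow> ('p, 'n) precat \<Rightarrow> ('o, 'm, 'p, 'n) func \<Rightarrow> ('o, 'm, 'p, 'n) func
     \<Rightarrow> ('o \<Rightarrow> 'n) \<Rightarrow> bool" where
  "natural_transformation C D F G \<eta> \<longleftrightarrow>
     (\<forall>x\<in>Ob C. \<eta> x \<in> Hom D (fobj F x) (fobj G x)) \<and>
     (\<forall>x\<in>Ob C. \<forall>y\<in>Ob C. \<forall>f\<in>Hom C x y.
        comp D (fobj F x) (fobj F y) (fobj G y) (\<eta> y) (farr F x y f)
          = comp D (fobj F x) (fobj G x) (fobj G y) (farr G x y f) (\<eta> x))"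

definition natural_isomorphism ::
  "('o, 'm) precat \<Rightarrow> ('p, 'n) precat \<Rightarrow> ('o, 'm, 'p, 'n) func \<Rightarrow> ('o, 'm, 'p, 'n) func
     \<Rightarrow> ('o \<Rightarrow> 'n) \<Rightarrow> bool" where
  "natural_isomorphism C D F G \<eta> \<longleftrightarrow>
     natural_transformation C D F G \<eta> \<and>
     (\<forall>x\<in>Ob C. is_iso D (fobj F x) (fobj G x) (\<eta> x))"

definition functor_eq ::
  "('o, 'm) precat \<Rightarrow> ('p, 'n) precat \<Rightarrow> ('o, 'm, 'p, 'n) func \<Rightarrow> ('o, 'm, 'p, 'n) func
     \<Rightarrow> bool" where
  "functor_eq C D F G \<longleftrightarrow> (\<exists>\<eta>. natural_isomorphism C D F G \<eta>)"

definition LT_cat :: "'d set \<Rightarrow> ('d \<times> 'd) set \<Rightarrow> ('d, unit) precat" where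
  "LT_cat \<Delta> le =
     \<lparr> Ob = \<Delta>,
       Hom = (\<lambda>a b. {u. (a, b) \<in> le}),
       ident = (\<lambda>a. ()),
       comp = (\<lambda>a b c g f. ()) \<rparr>"

(* Antisymmetry refers to equality of objects of LT_cat, not to HOL equality on \<Delta>;
   the second conjunct therefore follows from the first. *)
definition univalent_partial_order_on :: "'d set \<Rightarrow> ('d \<times> 'd) set \<Rightarrow> bool" where
  "univalent_partial_order_on \<Delta> le \<longleftrightarrow>
     preorder_on \<Delta> le \<and>
     (\<forall>a b. (a, b) \<in> le \<and> (b, a) \<in> le \<longrightarrow> obj_eq (LT_cat \<Delta> le) a b)"

end

theory Submission
  imports Defs
begin

text \<open>
  A functor on \<open>C\<close> acting on objects as \<open>I\<close> forces an arrow \<open>I x \<rightarrow> I y\<close> whenever \<open>C\<close> has an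
  arrow \<open>x \<rightarrow> y\<close>. The order \<open>\<le>\<close> is the least pre-order on \<open>\<Delta>\<close> with this property
  (\<open>induced_order\<close>). Passing to the transitive closure is essential: \<open>I\<close> may identify
  non-isomorphic objects, so \<open>x \<rightarrow> y\<close>, \<open>y' \<rightarrow> z\<close> with \<open>I y = I y'\<close> give \<open>I x \<le> I y \<le> I z\<close>
  although \<open>x\<close> and \<open>z\<close> may be unrelated in \<open>C\<close>.

  Everything else rests on the fact that all diagrams in a thin category commute. Functors into a
  thin category are therefore the same as monotone object maps (\<open>functor_into_thinI\<close>), and two of
  them are naturally isomorphic exactly when they agree on objects up to isomorphism
  (\<open>functor_eq_thin_iff\<close>). A functor \<open>K : C \<rightarrow> R\<close> with \<open>K x = I x\<close> up to isomorphism makes the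
  existence of arrows in \<open>R\<close> a pre-order on \<open>\<Delta>\<close> that contains the generating pairs, hence contains
  \<open>\<le>\<close>; so the identity on \<open>\<Delta>\<close> is the object map of a functor \<open>L\<close>, and \<open>L J\<close> agrees with \<open>K\<close> on
  objects up to isomorphism. Any competitor \<open>L'\<close> agrees with \<open>L\<close> up to isomorphism at every \<open>I x\<close>,
  and these exhaust \<open>\<Delta>\<close>.
\<close>

section \<open>Thin categories\<close>

lemma ident_in_Hom: "category C \<Longrightarrow> x \<in> Ob C \<Longrightarrow> ident C x \<in> Hom C x x"
  unfolding category_def by blast

lemma comp_in_Hom:
  assumes "category C" "x \<in> Ob C" "y \<in> Ob C" "z \<in> Ob C" "f \<in> Hom C x y" "g \<in> Hom C y z"
  shows "comp C x y z g f \<in> Hom C x z"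
  using assms unfolding category_def by blast

lemma thinD:
  assumes "thin C" "x \<in> Ob C" "y \<in> Ob C" "f \<in> Hom C x y" "g \<in> Hom C x y"
  shows "f = g"
  using assms unfolding thin_def by blast

text \<open>Any two opposite arrows are mutually inverse, since both composites are parallel to identities.\<close>

lemma is_iso_thinI:
  assumes "category R" "thin R" "a \<in> Ob R" "b \<in> Ob R" "f \<in> Hom R a b" "g \<in> Hom R b a"
  shows "is_iso R a b f"
proof -
  have "comp R a b a g f = ident R a"
    using assms by (blast intro: thinD comp_in_Hom ident_in_Hom)
  moreover have "comp R b a b f g = ident R b"
    using assms by (blast intro: thinD comp_in_Hom ident_in_Hom)
  ultimately show ?thesis
    using assms(5,6) unfolding is_iso_def by blast
qed

lemma obj_eq_thin_iff:
  assumes "category R" "thin R"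
  shows "obj_eq R a b \<longleftrightarrow>
    a \<in> Ob R \<and> b \<in> Ob R \<and> Hom R a b \<noteq> {} \<and> Hom R b a \<noteq> {}"
proof
  assume "obj_eq R a b"
  then show "a \<in> Ob R \<and> b \<in> Ob R \<and> Hom R a b \<noteq> {} \<and> Hom R b a \<noteq> {}"
    unfolding obj_eq_def is_iso_def by blast
next
  assume "a \<in> Ob R \<and> b \<in> Ob R \<and> Hom R a b \<noteq> {} \<and> Hom R b a \<noteq> {}"
  then show "obj_eq R a b"
    using is_iso_thinI[OF assms] unfolding obj_eq_def by blast
qed

lemma obj_eq_thin_sym:
  assumes "category R" "thin R" "obj_eq R a b"
  shows "obj_eq R b a"
  using assms by (auto simp: obj_eq_thin_iff)

lemma Hom_nonempty_trans:
  assumes "category R" "a \<in> Ob R" "b \<in> Ob R" "c \<in> Ob R" "Hom R a b \<noteq> {}" "Hom R b c \<noteq> {}"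
  shows "Hom R a c \<noteq> {}"
proof -
  obtain f g where "f \<in> Hom R a b" "g \<in> Hom R b c"
    using assms by blast
  then have "comp R a b c g f \<in> Hom R a c"
    using assms by (blast intro: comp_in_Hom)
  then show ?thesis by blast
qed

lemma obj_eq_thin_trans:
  assumes "category R" "thin R" "obj_eq R a b" "obj_eq R b c"
  shows "obj_eq R a c"
proof -
  have ab: "a \<in> Ob R" "b \<in> Ob R" "Hom R a b \<noteq> {}" "Hom R b a \<noteq> {}"
    and bc: "c \<in> Ob R" "Hom R b c \<noteq> {}" "Hom R c b \<noteq> {}"
    using assms by (auto simp: obj_eq_thin_iff)
  have "Hom R a c \<noteq> {}"
    by (rule Hom_nonempty_trans[OF assms(1) ab(1,2) bc(1) ab(3) bc(2)])
  moreover have "Hom R c a \<noteq> {}"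
    by (rule Hom_nonempty_trans[OF assms(1) bc(1) ab(2,1) bc(3) ab(4)])
  ultimately show ?thesis
    using ab(1) bc(1) by (simp add: obj_eq_thin_iff[OF assms(1,2)])
qed

section \<open>Functors into thin categories\<close>

text \<open>Both functor laws equate parallel arrows of the target, so they hold automatically.\<close>

lemma functor_into_thinI:
  assumes C: "category C" and R: "category R" "thin R"
    and ob: "\<And>x. x \<in> Ob C \<Longrightarrow> fobj F x \<in> Ob R"
    and ar: "\<And>x y f. x \<in> Ob C \<Longrightarrow> y \<in> Ob C \<Longrightarrow> f \<in> Hom C x y
      \<Longrightarrow> farr F x y f \<in> Hom R (fobj F x) (fobj F y)"
  shows "is_functor C R F"
  unfolding is_functor_def
proof (intro conjI ballI)
  fix x assume x: "x \<in> Ob C"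
  show "farr F x x (ident C x) = ident R (fobj F x)"
    by (rule thinD[OF R(2) ob[OF x] ob[OF x]
          ar[OF x x ident_in_Hom[OF C x]] ident_in_Hom[OF R(1) ob[OF x]]])
next
  fix x y z f g
  assume x: "x \<in> Ob C" and y: "y \<in> Ob C" and z: "z \<in> Ob C"
    and f: "f \<in> Hom C x y" and g: "g \<in> Hom C y z"
  show "farr F x z (comp C x y z g f)
      = comp R (fobj F x) (fobj F y) (fobj F z) (farr F y z g) (farr F x y f)"
    by (rule thinD[OF R(2) ob[OF x] ob[OF z]
          ar[OF x z comp_in_Hom[OF C x y z f g]]
          comp_in_Hom[OF R(1) ob[OF x] ob[OF y] ob[OF z] ar[OF x y f] ar[OF y z g]]])
qed (use ob ar in blast)+

lemma functor_obD: "is_functor C D F \<Longrightarrow> x \<in> Ob C \<Longrightarrow> fobj F x \<in> Ob D"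
  unfolding is_functor_def by blast

lemma functor_arD:
  assumes "is_functor C D F" "x \<in> Ob C" "y \<in> Ob C" "f \<in> Hom C x y"
  shows "farr F x y f \<in> Hom D (fobj F x) (fobj F y)"
  using assms unfolding is_functor_def by blast

text \<open>
  For the nontrivial direction, any choice of isomorphisms \<open>F x \<rightarrow> G x\<close> works: naturality squares
  commute by thinness.
\<close>

lemma functor_eq_thin_iff:
  assumes R: "category R" "thin R"
    and F: "is_functor C R F" and G: "is_functor C R G"
  shows "functor_eq C R F G \<longleftrightarrow> (\<forall>x\<in>Ob C. obj_eq R (fobj F x) (fobj G x))"
proof
  assume "functor_eq C R F G"
  then obtain \<eta> where "\<forall>x\<in>Ob C. is_iso R (fobj F x) (fobj G x) (\<eta> x)"
    unfolding functor_eq_def natural_isomorphism_def by blast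
  then show "\<forall>x\<in>Ob C. obj_eq R (fobj F x) (fobj G x)"
    using functor_obD[OF F] functor_obD[OF G] unfolding obj_eq_def by blast
next
  assume "\<forall>x\<in>Ob C. obj_eq R (fobj F x) (fobj G x)"
  then have "\<forall>x\<in>Ob C. \<exists>f. is_iso R (fobj F x) (fobj G x) f"
    unfolding obj_eq_def by blast
  then obtain \<eta> where iso: "\<forall>x\<in>Ob C. is_iso R (fobj F x) (fobj G x) (\<eta> x)"
    by (auto dest: bchoice)
  then have \<eta>: "\<eta> x \<in> Hom R (fobj F x) (fobj G x)" if "x \<in> Ob C" for x
    using that unfolding is_iso_def by blast
  have "comp R (fobj F x) (fobj F y) (fobj G y) (\<eta> y) (farr F x y f)
      = comp R (fobj F x) (fobj G x) (fobj G y) (farr G x y f) (\<eta> x)"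
    if x: "x \<in> Ob C" and y: "y \<in> Ob C" and f: "f \<in> Hom C x y" for x y f
  proof -
    note obs = functor_obD[OF F x] functor_obD[OF F y] functor_obD[OF G x] functor_obD[OF G y]
    show ?thesis
      by (rule thinD[OF R(2) obs(1) obs(4)
            comp_in_Hom[OF R(1) obs(1,2,4) functor_arD[OF F x y f] \<eta>[OF y]]
            comp_in_Hom[OF R(1) obs(1,3,4) \<eta>[OF x] functor_arD[OF G x y f]]])
  qed
  then show "functor_eq C R F G"
    using iso \<eta> unfolding functor_eq_def natural_isomorphism_def natural_transformation_def
    by blast
qed

lemma func_comp_functor:
  assumes C: "category C" and R: "category R" "thin R"
    and J: "is_functor C D J" and L: "is_functor D R L"
  shows "is_functor C R (func_comp L J)"
  by (rule functor_into_thinI[OF C R])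
    (simp_all add: func_comp_def functor_obD[OF L] functor_arD[OF L] functor_obD[OF J]
      functor_arD[OF J])

section \<open>Pre-orders as thin categories\<close>

lemma category_LT_cat: "preorder_on \<Delta> le \<Longrightarrow> category (LT_cat \<Delta> le)"
  unfolding category_def LT_cat_def preorder_on_def by (auto dest: refl_onD transD)

lemma thin_LT_cat: "thin (LT_cat \<Delta> le)"
  unfolding thin_def by simp

lemma univalent_partial_order_onI:
  assumes pre: "preorder_on \<Delta> le"
  shows "univalent_partial_order_on \<Delta> le"
proof -
  have "le \<subseteq> \<Delta> \<times> \<Delta>"
    using pre unfolding preorder_on_def by blast
  then show ?thesis
    using pre unfolding univalent_partial_order_on_def
      obj_eq_thin_iff[OF category_LT_cat[OF pre] thin_LT_cat]
    by (auto simp: LT_cat_def)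
qed

section \<open>The pre-order generated by the arrows of a category\<close>

definition arrow_pairs :: "('c, 'm) precat \<Rightarrow> ('c \<Rightarrow> 'd) \<Rightarrow> ('d \<times> 'd) set" where
  "arrow_pairs C I = {(I x, I y) | x y. x \<in> Ob C \<and> y \<in> Ob C \<and> Hom C x y \<noteq> {}}"

definition induced_order :: "('c, 'm) precat \<Rightarrow> ('c \<Rightarrow> 'd) \<Rightarrow> ('d \<times> 'd) set" where
  "induced_order C I = (arrow_pairs C I)\<^sup>+"

text \<open>Identities of \<open>C\<close> make the generating pairs reflexive on the image of \<open>I\<close>.\<close>

lemma preorder_on_induced_order:
  assumes C: "category C"
  shows "preorder_on (I ` Ob C) (induced_order C I)"
proof -
  have sub: "arrow_pairs C I \<subseteq> I ` Ob C \<times> I ` Ob C"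
    unfolding arrow_pairs_def by blast
  have "(I x, I x) \<in> arrow_pairs C I" if "x \<in> Ob C" for x
    using that ident_in_Hom[OF C that] unfolding arrow_pairs_def by blast
  then have "(a, a) \<in> induced_order C I" if "a \<in> I ` Ob C" for a
    using that unfolding induced_order_def by auto
  moreover have "induced_order C I \<subseteq> I ` Ob C \<times> I ` Ob C"
    unfolding induced_order_def by (rule trancl_subset_Sigma[OF sub])
  moreover have "trans (induced_order C I)"
    unfolding induced_order_def by (rule trans_trancl)
  ultimately show ?thesis
    unfolding preorder_on_def refl_on_def by blast
qed

lemma induced_orderI:
  assumes "x \<in> Ob C" "y \<in> Ob C" "f \<in> Hom C x y"
  shows "(I x, I y) \<in> induced_order C I"
  using assms unfolding induced_order_def arrow_pairs_def by blast

text \<open>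
  Having an arrow in \<open>R\<close> is transitive, so it is enough to treat an arrow
  \<open>f : x \<rightarrow> y\<close> of \<open>C\<close>, for which \<open>I x \<rightarrow> K x \<rightarrow> K y \<rightarrow> I y\<close> is the required arrow.
\<close>

lemma induced_order_least:
  assumes R: "category R" "thin R"
    and K: "is_functor C R K"
    and KI: "\<And>x. x \<in> Ob C \<Longrightarrow> obj_eq R (fobj K x) (I x)"
    and ab: "(a, b) \<in> induced_order C I"
  shows "a \<in> Ob R \<and> b \<in> Ob R \<and> Hom R a b \<noteq> {}"
proof -
  have gen: "a \<in> Ob R \<and> b \<in> Ob R \<and> Hom R a b \<noteq> {}"
    if pair: "(a, b) \<in> arrow_pairs C I" for a b
  proof -
    obtain x y f where xy: "x \<in> Ob C" "y \<in> Ob C" "f \<in> Hom C x y" and ab: "a = I x" "b = I y"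
      using pair unfolding arrow_pairs_def by blast
    have x: "fobj K x \<in> Ob R" "I x \<in> Ob R" "Hom R (I x) (fobj K x) \<noteq> {}"
      using KI[OF xy(1)] by (auto simp: obj_eq_thin_iff[OF R])
    have y: "fobj K y \<in> Ob R" "I y \<in> Ob R" "Hom R (fobj K y) (I y) \<noteq> {}"
      using KI[OF xy(2)] by (auto simp: obj_eq_thin_iff[OF R])
    have "Hom R (fobj K x) (fobj K y) \<noteq> {}"
      using functor_arD[OF K xy] by blast
    from Hom_nonempty_trans[OF R(1) x(2,1) y(1) x(3) this]
    have "Hom R (I x) (fobj K y) \<noteq> {}" .
    from Hom_nonempty_trans[OF R(1) x(2) y(1,2) this y(3)]
    show ?thesis using x y ab by blast
  qed
  from ab have "(a, b) \<in> (arrow_pairs C I)\<^sup>+"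
    unfolding induced_order_def .
  then show ?thesis
  proof (induction rule: trancl_induct)
    case (base b)
    then show ?case by (rule gen)
  next
    case (step b c)
    then show ?case
      using gen[OF step.hyps(2)] Hom_nonempty_trans[OF R(1), of a b c] by blast
  qed
qed

section \<open>The universal thin category under an invariant\<close>

theorem theorem3:
  fixes C :: "('c, 'm) precat"
    and \<Delta> :: "'d set"
    and I :: "'c \<Rightarrow> 'd"
  assumes "category C"
    and "isomorphism_invariant C \<Delta> I"
    and "I ` Ob C = \<Delta>"
  shows "\<exists>(le :: ('d \<times> 'd) set) (J :: ('c, 'm, 'd, unit) func).
    univalent_partial_order_on \<Delta> le \<and>
    is_functor C (LT_cat \<Delta> le) J \<and>
    (\<forall>x\<in>Ob C. obj_eq (LT_cat \<Delta> le) (fobj J x) (I x)) \<and>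
    (\<forall>(R :: ('d, 'r) precat) (K :: ('c, 'm, 'd, 'r) func).
       category R \<and> thin R \<and> Ob R = \<Delta> \<and>
       is_functor C R K \<and> (\<forall>x\<in>Ob C. obj_eq R (fobj K x) (I x)) \<longrightarrow>
       (\<exists>L. is_functor (LT_cat \<Delta> le) R L \<and>
          (\<exists>\<eta>. natural_isomorphism C R (func_comp L J) K \<eta>) \<and>
          (\<forall>L'. is_functor (LT_cat \<Delta> le) R L' \<and>
             (\<exists>\<eta>'. natural_isomorphism C R (func_comp L' J) K \<eta>') \<longrightarrow>
             functor_eq (LT_cat \<Delta> le) R L' L)))"
proof -
  define le where "le = induced_order C I"
  define J :: "('c, 'm, 'd, unit) func" where "J = \<lparr> fobj = I, farr = (\<lambda>x y f. ()) \<rparr>"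
  let ?LT = "LT_cat \<Delta> le"
  have pre: "preorder_on \<Delta> le"
    using preorder_on_induced_order[OF assms(1), of I] unfolding le_def assms(3) .
  note LT = category_LT_cat[OF pre] thin_LT_cat[of \<Delta> le]
  have J: "is_functor C ?LT J"
  proof (rule functor_into_thinI[OF assms(1) LT])
    show "fobj J x \<in> Ob ?LT" if "x \<in> Ob C" for x
      using that assms(3) by (auto simp: J_def LT_cat_def)
    show "farr J x y f \<in> Hom ?LT (fobj J x) (fobj J y)"
      if "x \<in> Ob C" "y \<in> Ob C" "f \<in> Hom C x y" for x y f
      using induced_orderI[OF that] by (simp add: J_def LT_cat_def le_def)
  qed
  have JI: "obj_eq ?LT (fobj J x) (I x)" if "x \<in> Ob C" for x
    using functor_obD[OF J that] ident_in_Hom[OF LT(1) functor_obD[OF J that]]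
    unfolding obj_eq_thin_iff[OF LT] by (auto simp: J_def)
  have universal: "\<exists>L. is_functor ?LT R L \<and>
      (\<exists>\<eta>. natural_isomorphism C R (func_comp L J) K \<eta>) \<and>
      (\<forall>L'. is_functor ?LT R L' \<and> (\<exists>\<eta>'. natural_isomorphism C R (func_comp L' J) K \<eta>') \<longrightarrow>
        functor_eq ?LT R L' L)"
    if R: "category R" "thin R" and ObR: "Ob R = \<Delta>" and K: "is_functor C R K"
      and KI: "\<forall>x\<in>Ob C. obj_eq R (fobj K x) (I x)"
    for R :: "('d, 'r) precat" and K :: "('c, 'm, 'd, 'r) func"
  proof -
    \<comment> \<open>The chosen arrow is meaningful only when \<open>(a, b) \<in> le\<close>; by thinness it is then the only one.\<close>
    define L :: "('d, unit, 'd, 'r) func"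
      where "L = \<lparr> fobj = (\<lambda>a. a), farr = (\<lambda>a b u. SOME f. f \<in> Hom R a b) \<rparr>"
    have L: "is_functor ?LT R L"
    proof (rule functor_into_thinI[OF LT(1) R])
      show "fobj L a \<in> Ob R" if "a \<in> Ob ?LT" for a
        using that by (simp add: L_def LT_cat_def ObR)
      show "farr L a b u \<in> Hom R (fobj L a) (fobj L b)" if "u \<in> Hom ?LT a b" for a b u
      proof -
        have "(a, b) \<in> induced_order C I"
          using that by (simp add: LT_cat_def le_def split: if_splits)
        then have "Hom R a b \<noteq> {}"
          using induced_order_least[OF R K] KI by blast
        then show ?thesis
          by (simp add: L_def some_in_eq)
      qed
    qed
    have IK: "obj_eq R (I x) (fobj K x)" if "x \<in> Ob C" for x
      using KI that obj_eq_thin_sym[OF R] by blast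
    have "functor_eq C R (func_comp L J) K"
      using IK unfolding functor_eq_thin_iff[OF R func_comp_functor[OF assms(1) R J L] K]
      by (simp add: func_comp_def L_def J_def)
    moreover have "functor_eq ?LT R L' L"
      if L': "is_functor ?LT R L'" and eq: "functor_eq C R (func_comp L' J) K" for L'
      unfolding functor_eq_thin_iff[OF R L' L]
    proof
      fix a assume "a \<in> Ob ?LT"
      then obtain x where x: "x \<in> Ob C" and a: "a = I x"
        using assms(3) by (auto simp: LT_cat_def)
      have "obj_eq R (fobj L' (I x)) (fobj K x)"
        using eq x unfolding functor_eq_thin_iff[OF R func_comp_functor[OF assms(1) R J L'] K]
        by (simp add: func_comp_def J_def)
      then have "obj_eq R (fobj L' (I x)) (I x)"
        using KI x obj_eq_thin_trans[OF R] by blast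
      then show "obj_eq R (fobj L' a) (fobj L a)"
        by (simp add: L_def a)
    qed
    ultimately show ?thesis
      using L unfolding functor_eq_def by blast
  qed
  show ?thesis
    using univalent_partial_order_onI[OF pre] J JI universal
    by (intro exI[of _ le] exI[of _ J]) blast
qed

end
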